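(* Let $\mathbb{T}$ be a time scale that is unbounded from above and has a minimum, and let $f:\mathbb{T}\rightarrow\mathbb{R}$ be a measurable function. The following statements are equivalent: (i) $f$ is $\Delta$-convergent (i.e. $f$ is $\Delta$-convergent to some number $L\in\mathbb{R}$); (ii) $f$ is $\Delta$-Cauchy; (iii) there exists a measurable and convergent function $g:\mathbb{T}\rightarrow\mathbb{R}$ (convergent meaning that $\lim_{t\to\infty} g(t)$ exists in $\mathbb{R}$, $t\in\mathbb{T}$) such that $f(t)=g(t)$ for $\Delta$-almost all $t$.
   Context: A time scale $\mathbb{T}$ is a nonempty closed subset of $\mathbb{R}$. Throughout, $\mathbb{T}$ is unbounded from above and has a minimum $a=\min\mathbb{T}$. The forward jump operator is $\sigma(t)=\inf\{s\in\mathbb{T}: s>t\}$ for $t\in\mathbb{T}$. Lebesgue $\Delta$-measure: let $\mathcal{S}$ be the family of all sets $[c,d)=\{t\in\mathbb{T}: c\le t<d\}$ with $c,d\in\mathbb{T}$, $c\le d$, and $m([c,d))=d-c$. Define the outer measure on subsets $A\subset\mathbb{T}$ by $m^*(A)=\inf\{\sum_{n=1}^\infty m(A_n): A_n\in\mathcal{S},\ A\subset\bigcup_{n=1}^\infty A_n\}$ (and $m^*(A)=\infty$ if no such cover exists). Let $\mathcal{M}(m^* )$ be the $\sigma$-algebra of Carathéodory $m^*$-measurable sets, and let $\mu_\Delta$ be the restriction of $m^*$ to $\mathcal{M}(m^* )$. "Measurable" ($\Delta$-measurable) set means a member of $\mathcal{M}(m^* )$. A function $f:\mathbb{T}\to\mathbb{R}$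 is measurable if $f^{-1}(\mathcal{O})\in\mathcal{M}(m^* )$ for every open $\mathcal{O}\subset\mathbb{R}$. $\Delta$-density: for a measurable $A\subset\mathbb{T}$ put $A(t)=\{s\in A: s\le t\}$, $t\in\mathbb{T}$, and $$\delta_\Delta(A)=\lim_{t\to\infty,\ t\in\mathbb{T}}\frac{\mu_\Delta(A(t))}{\sigma(t)-a}$$ if this limit exists. Writing $\delta_\Delta(A)=c$ means that $A$ is measurable, the limit exists and equals $c$. A property holds for $\Delta$-almost all $t$ if it holds for all $t\in\mathbb{T}$ except for a set of $\Delta$-density zero. $f:\mathbb{T}\to\mathbb{R}$ is $\Delta$-convergent to $L$ if for each $\varepsilon>0$ there exists $K_\varepsilon\subset\mathbb{T}$ with $\delta_\Delta(K_\varepsilon)=1$ and $|f(t)-L|<\varepsilon$ for all $t\in K_\varepsilon$. $f:\mathbb{T}\to\mathbb{R}$ is $\Delta$-Cauchy if for each $\varepsilon>0$ there exist $K_\varepsilon\subset\mathbb{T}$ and $t_0\in\mathbb{T}$ such that $\delta_\Delta(K_\varepsilon)=1$ and $|f(t)-f(t_0)|<\varepsilon$ for all $t\in K_\varepsilon$. *)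

theory Defs
  imports "HOL-Analysis.Analysis"
begin

definition time_scale :: "real set \<Rightarrow> bool"
  where "time_scale T \<longleftrightarrow> T \<noteq> {} \<and> closed T"

definition has_minimum :: "real set \<Rightarrow> bool"
  where "has_minimum T \<longleftrightarrow> (\<exists>a\<in>T. \<forall>t\<in>T. a \<le> t)"

definition ts_min :: "real set \<Rightarrow> real"
  where "ts_min T = (LEAST a. a \<in> T)"

definition forward_jump :: "real set \<Rightarrow> real \<Rightarrow> real"
  where "forward_jump T t = Inf {s \<in> T. s > t}"

definition at_top_in :: "real set \<Rightarrow> real filter"
  where "at_top_in T = inf at_top (principal T)"

lemma eventually_at_top_in:
  "eventually P (at_top_in T) \<longleftrightarrow> (\<exists>N. \<forall>t\<in>T. N \<le> t \<longrightarrow> P t)"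
  by (auto simp: at_top_in_def eventually_inf_principal eventually_at_top_linorder)


section \<open>The Lebesgue Delta-measure\<close>

definition ts_interval :: "real set \<Rightarrow> real \<Rightarrow> real \<Rightarrow> real set"
  where "ts_interval T c d = {t \<in> T. c \<le> t \<and> t < d}"

definition ts_intervals :: "real set \<Rightarrow> real set set"
  where "ts_intervals T = {ts_interval T c d | c d. c \<in> T \<and> d \<in> T \<and> c \<le> d}"

text \<open>The length is a function of the interval as a set; lemma \<open>ts_length_interval\<close>
  shows that it does not depend on the choice of the end points.\<close>

definition ts_length :: "real set \<Rightarrow> real set \<Rightarrow> ennreal"
  where "ts_length T A =
    (THE l. \<exists>c\<in>T. \<exists>d\<in>T. c \<le> d \<and> A = ts_interval T c d \<and> l = ennreal (d - c))"

lemma ts_interval_cong_length: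
  assumes "c \<in> T" "d \<in> T" "c \<le> d" "c' \<in> T" "d' \<in> T" "c' \<le> d'"
    and eq: "ts_interval T c d = ts_interval T c' d'"
  shows "d - c = d' - c'"
proof -
  have *: "t \<in> T \<Longrightarrow> c \<le> t \<and> t < d \<longleftrightarrow> c' \<le> t \<and> t < d'" for t
    using eq unfolding ts_interval_def by blast
  show ?thesis
    using *[of c] *[of d] *[of c'] *[of d'] assms by linarith
qed

lemma ts_length_interval:
  assumes "c \<in> T" "d \<in> T" "c \<le> d"
  shows "ts_length T (ts_interval T c d) = ennreal (d - c)"
  unfolding ts_length_def
proof (rule the_equality)
  fix l assume "\<exists>c'\<in>T. \<exists>d'\<in>T. c' \<le> d' \<and> ts_interval T c d = ts_interval T c' d' \<and> l = ennreal (d' - c')"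
  then show "l = ennreal (d - c)"
    using ts_interval_cong_length[OF assms] by metis
qed (use assms in blast)

text \<open>The covering sets are not required to be disjoint, in contrast to the library constant
  \<^const>\<open>outer_measure\<close>. The infimum of the empty set is \<open>\<infinity>\<close>.\<close>

definition delta_outer :: "real set \<Rightarrow> real set \<Rightarrow> ennreal"
  where "delta_outer T X =
    (INF A\<in>{A :: nat \<Rightarrow> real set. range A \<subseteq> ts_intervals T \<and> X \<subseteq> (\<Union>n. A n)}.
      \<Sum>n. ts_length T (A n))"

definition delta_sets :: "real set \<Rightarrow> real set set"
  where "delta_sets T = lambda_system T (Pow T) (delta_outer T)"

lemma mem_delta_sets_iff:
  "A \<in> delta_sets T \<longleftrightarrow> A \<subseteq> T \<and>
    (\<forall>X. X \<subseteq> T \<longrightarrow> delta_outer T (X \<inter> A) + delta_outer T (X - A) = delta_outer T X)"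
  unfolding delta_sets_def algebra.lambda_system_eq[OF algebra_Pow] by auto

definition delta_measure :: "real set \<Rightarrow> real measure"
  where "delta_measure T = measure_of T (delta_sets T) (delta_outer T)"

lemma delta_outer_le:
  "range A \<subseteq> ts_intervals T \<Longrightarrow> X \<subseteq> (\<Union>n. A n) \<Longrightarrow> delta_outer T X \<le> (\<Sum>n. ts_length T (A n))"
  unfolding delta_outer_def by (rule INF_lower) auto

lemma delta_outer_close:
  assumes "delta_outer T X < e"
  obtains A where "range A \<subseteq> ts_intervals T" "X \<subseteq> (\<Union>n. A n)" "(\<Sum>n. ts_length T (A n)) < e"
  using assms unfolding delta_outer_def INF_less_iff by blast

lemma outer_measure_space_delta_outer:
  assumes "T \<noteq> {}"
  shows "outer_measure_space (Pow T) (delta_outer T)"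
proof -
  obtain c where c: "c \<in> T" using assms by auto
  have "delta_outer T {} \<le> (\<Sum>n::nat. ts_length T (ts_interval T c c))"
    by (rule delta_outer_le) (use c in \<open>auto simp: ts_intervals_def\<close>)
  then have "positive (Pow T) (delta_outer T)"
    using c by (simp add: positive_def ts_length_interval)
  moreover have "increasing (Pow T) (delta_outer T)"
    unfolding increasing_def delta_outer_def by (intro ballI impI INF_superset_mono) auto
  moreover have "countably_subadditive (Pow T) (delta_outer T)"
    unfolding countably_subadditive_def
  proof (intro allI impI)
    fix A :: "nat \<Rightarrow> real set"
    show "delta_outer T (\<Union>i. A i) \<le> (\<Sum>n. delta_outer T (A n))"
    proof (rule ennreal_le_epsilon)
      fix e :: real
      assume e: "0 < e" and fin: "(\<Sum>n. delta_outer T (A n)) < top"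
      have "\<exists>B. range B \<subseteq> ts_intervals T \<and> A n \<subseteq> (\<Union>i. B i) \<and>
          (\<Sum>i. ts_length T (B i)) \<le> delta_outer T (A n) + e * (1/2) ^ Suc n" for n
      proof -
        have "delta_outer T (A n) < delta_outer T (A n) + e * (1/2) ^ Suc n"
          using e fin by (auto simp: less_top dest!: ennreal_suminf_lessD)
        then show ?thesis
          by (rule delta_outer_close) (auto intro: less_imp_le)
      qed
      then obtain B where B: "\<And>n. range (B n) \<subseteq> ts_intervals T" "\<And>n. A n \<subseteq> (\<Union>i. B n i)"
        "\<And>n. (\<Sum>i. ts_length T (B n i)) \<le> delta_outer T (A n) + e * (1/2) ^ Suc n"
        by metis
      define C where "C = case_prod B \<circ> prod_decode"
      have "delta_outer T (\<Union>i. A i) \<le> (\<Sum>i. ts_length T (C i))"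
      proof (rule delta_outer_le)
        show "range C \<subseteq> ts_intervals T"
          using B(1) by (auto simp: C_def split_def)
        show "(\<Union>i. A i) \<subseteq> (\<Union>i. C i)"
          using B(2) by (auto simp: C_def subset_eq) (metis prod.case prod_encode_inverse)
      qed
      also have "\<dots> = (\<Sum>n. \<Sum>i. ts_length T (B n i))"
        unfolding C_def comp_def by (intro suminf_ennreal_2dimen) auto
      also have "\<dots> \<le> (\<Sum>n. delta_outer T (A n) + e * (1/2) ^ Suc n)"
        by (intro suminf_le allI B(3)) auto
      also have "\<dots> = (\<Sum>n. delta_outer T (A n)) + (\<Sum>n. ennreal e * ennreal ((1/2) ^ Suc n))"
        using e by (subst suminf_add[symmetric])
          (auto simp del: ennreal_suminf_cmult simp add: ennreal_mult[symmetric])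
      also have "\<dots> = (\<Sum>n. delta_outer T (A n)) + e"
        unfolding ennreal_suminf_cmult
        by (subst suminf_ennreal_eq[OF zero_le_power power_half_series]) auto
      finally show "delta_outer T (\<Union>i. A i) \<le> (\<Sum>n. delta_outer T (A n)) + e" .
    qed
  qed
  ultimately show ?thesis
    by (simp add: outer_measure_space_def)
qed

lemma measure_space_delta:
  "T \<noteq> {} \<Longrightarrow> measure_space T (delta_sets T) (delta_outer T)"
  unfolding delta_sets_def
  by (intro sigma_algebra.caratheodory_lemma sigma_algebra_Pow outer_measure_space_delta_outer)

lemma space_delta_measure [simp]: "space (delta_measure T) = T"
  by (simp add: delta_measure_def space_measure_of_conv)

lemma sets_delta_measure: "T \<noteq> {} \<Longrightarrow> sets (delta_measure T) = delta_sets T"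
  using measure_space_delta[of T] unfolding delta_measure_def
  by (simp add: measure_space_def sigma_algebra.sets_measure_of_eq)

lemma emeasure_delta_measure:
  assumes "T \<noteq> {}" "A \<in> delta_sets T"
  shows "emeasure (delta_measure T) A = delta_outer T A"
  using measure_space_delta[OF assms(1)] assms sets_delta_measure[OF assms(1)]
  by (intro emeasure_measure_of[OF delta_measure_def])
    (auto simp: measure_space_def delta_sets_def lambda_system_def)

lemma borel_measurable_delta_iff:
  fixes f :: "real \<Rightarrow> real"
  assumes "T \<noteq> {}"
  shows "f \<in> borel_measurable (delta_measure T) \<longleftrightarrow>
    (\<forall>U. open U \<longrightarrow> {t \<in> T. f t \<in> U} \<in> delta_sets T)"
proof
  assume f: "f \<in> borel_measurable (delta_measure T)"
  show "\<forall>U. open U \<longrightarrow> {t \<in> T. f t \<in> U} \<in> delta_sets T"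
  proof (intro allI impI)
    fix U :: "real set" assume "open U"
    then have "f -` U \<inter> T \<in> delta_sets T"
      using measurable_sets[OF f, of U] assms by (simp add: sets_delta_measure)
    then show "{t \<in> T. f t \<in> U} \<in> delta_sets T"
      by (simp add: vimage_def Int_def conj_commute)
  qed
next
  assume "\<forall>U. open U \<longrightarrow> {t \<in> T. f t \<in> U} \<in> delta_sets T"
  then show "f \<in> borel_measurable (delta_measure T)"
    by (intro borel_measurableI)
      (simp add: sets_delta_measure assms vimage_def Int_def conj_commute)
qed


section \<open>Delta-density\<close>

definition has_delta_density :: "real set \<Rightarrow> real set \<Rightarrow> real \<Rightarrow> bool"
  where "has_delta_density T A c \<longleftrightarrow> A \<in> sets (delta_measure T) \<and>
    ((\<lambda>t. measure (delta_measure T) {s \<in> A. s \<le> t} / (forward_jump T t - ts_min T)) \<longlongrightarrow> c)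
      (at_top_in T)"

definition delta_almost_all :: "real set \<Rightarrow> (real \<Rightarrow> bool) \<Rightarrow> bool"
  where "delta_almost_all T P \<longleftrightarrow> has_delta_density T {t \<in> T. \<not> P t} 0"

text \<open>A function on the time scale is represented by a function on the reals; all notions below
  only depend on its values on \<open>T\<close>.\<close>

definition delta_converges_to :: "real set \<Rightarrow> (real \<Rightarrow> real) \<Rightarrow> real \<Rightarrow> bool"
  where "delta_converges_to T f L \<longleftrightarrow>
    (\<forall>\<epsilon>>0. \<exists>K\<subseteq>T. has_delta_density T K 1 \<and> (\<forall>t\<in>K. \<bar>f t - L\<bar> < \<epsilon>))"

definition delta_Cauchy :: "real set \<Rightarrow> (real \<Rightarrow> real) \<Rightarrow> bool"
  where "delta_Cauchy T f \<longleftrightarrow>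
    (\<forall>\<epsilon>>0. \<exists>K\<subseteq>T. \<exists>t0\<in>T. has_delta_density T K 1 \<and> (\<forall>t\<in>K. \<bar>f t - f t0\<bar> < \<epsilon>))"

end

theory Submission
  imports Defs
begin

text \<open>
  Write \<open>\<mu>\<close> for the \<open>\<Delta>\<close>-measure, \<open>\<sigma>\<close> for the forward jump, \<open>a = min T\<close> and
  \<open>T(t) = {s \<in> T. s \<le> t}\<close>. Everything rests on the fact that
  \<open>T(t)\<close> is measurable with \<open>\<mu>(T(t)) = \<sigma>(t) - a\<close> (lemma \<open>measure_initial\<close>): the normalisation in
  the definition of density is the right one, so \<open>T\<close> has density one, and the sets of density zero
  are the complements of the sets of density one. The sets of density zero then behave as those of
  classical asymptotic density on the natural numbers: they form an ideal of measurable sets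
  that contains the bounded ones, and by a diagonal argument an increasing sequence of them can be
  swallowed, up to bounded sets, by a single one (lemma \<open>density_zero_almost_union\<close>).

  If \<open>f\<close> is \<open>\<Delta>\<close>-convergent to \<open>L\<close>, it is \<open>\<Delta>\<close>-Cauchy because a set of density one has a point
  at which to evaluate \<open>f\<close>. Conversely, if on a set \<open>K\<^sub>n\<close> of density one \<open>f\<close> is within
  \<open>1/(n+1)\<close> of a number \<open>x\<^sub>n\<close>, then any two of the \<open>K\<^sub>n\<close> meet, so the \<open>x\<^sub>n\<close> form a Cauchy
  sequence; its limit is the \<open>\<Delta>\<close>-limit of \<open>f\<close>. For the convergent function \<open>g\<close>, apply the diagonal
  argument to the sets \<open>{t. 1/(n+1) \<le> \<bar>f t - L\<bar>}\<close> and overwrite \<open>f\<close> by \<open>L\<close> on the resulting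
  set of density zero: outside it \<open>f\<close> tends to \<open>L\<close> in the ordinary sense. In the other
  direction, \<open>f\<close> can be far from the limit of \<open>g\<close> only on a bounded set or where \<open>f\<close> and
  \<open>g\<close> differ.
\<close>

section \<open>The forward jump operator\<close>

locale unbounded_time_scale =
  fixes T :: "real set"
  assumes ts: "time_scale T" and unbounded: "\<not> bdd_above T" and minimum: "has_minimum T"
begin

lemma T_nonempty: "T \<noteq> {}" and T_closed: "closed T"
  using ts by (auto simp: time_scale_def)

lemma ts_min_mem: "ts_min T \<in> T" and ts_min_le: "t \<in> T \<Longrightarrow> ts_min T \<le> t"
proof -
  obtain a where a: "a \<in> T" "\<forall>t\<in>T. a \<le> t"
    using minimum by (auto simp: has_minimum_def)
  then have "ts_min T = a"
    unfolding ts_min_def by (intro Least_equality) auto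
  then show "ts_min T \<in> T" "t \<in> T \<Longrightarrow> ts_min T \<le> t"
    using a by auto
qed

lemma ex_greater: "\<exists>s\<in>T. x < s"
  using unbounded by (meson bdd_above.I not_le)

lemma later_points: "{s \<in> T. t < s} \<noteq> {}" "bdd_below {s \<in> T. t < s}"
  using ex_greater[of t] by (auto intro!: bdd_belowI[of _ t])

lemma forward_jump_le: "d \<in> T \<Longrightarrow> t < d \<Longrightarrow> forward_jump T t \<le> d"
  unfolding forward_jump_def by (rule cInf_lower) (use later_points in auto)

lemma le_forward_jump: "t \<le> forward_jump T t"
  unfolding forward_jump_def by (rule cInf_greatest) (use later_points in auto)

lemma forward_jump_mem: "forward_jump T t \<in> T"
proof -
  have "Inf {s \<in> T. t < s} \<in> closure {s \<in> T. t < s}"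
    using later_points by (intro closure_contains_Inf)
  also have "\<dots> \<subseteq> T"
    using T_closed by (intro closure_minimal) auto
  finally show ?thesis
    by (simp add: forward_jump_def)
qed

lemma forward_jump_approx:
  assumes "forward_jump T t < x"
  obtains d where "d \<in> T" "t < d" "d < x"
  using cInf_lessD[OF later_points(1), of t x] assms by (auto simp: forward_jump_def)


section \<open>The measure of an initial segment\<close>

lemma delta_outer_mono: "X \<subseteq> Y \<Longrightarrow> delta_outer T X \<le> delta_outer T Y"
  unfolding delta_outer_def by (intro INF_superset_mono) auto

text \<open>Countable subadditivity in \<^const>\<open>outer_measure_space\<close> speaks of disjoint families only;
  monotonicity extends it to covers whose members overlap.\<close>

lemma delta_outer_subadditive:
  assumes "\<And>n::nat. A n \<subseteq> T"
  shows "delta_outer T (\<Union>n. A n) \<le> (\<Sum>n. delta_outer T (A n))"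
proof -
  have D: "disjointed A n \<subseteq> A n" for n
    by (rule disjointed_subset)
  have "range (disjointed A) \<subseteq> Pow T" "\<Union> (range (disjointed A)) \<in> Pow T"
    using D assms by blast+
  then have "delta_outer T (\<Union>n. disjointed A n) \<le> (\<Sum>n. delta_outer T (disjointed A n))"
    using outer_measure_space_delta_outer[OF T_nonempty] disjoint_family_disjointed[of A]
    unfolding outer_measure_space_def countably_subadditive_def by blast
  also have "\<dots> \<le> (\<Sum>n. delta_outer T (A n))"
    by (intro suminf_le delta_outer_mono D) auto
  finally show ?thesis
    by (simp add: UN_disjointed_eq)
qed

lemma delta_outer_Un:
  assumes "A \<subseteq> T" "B \<subseteq> T"
  shows "delta_outer T (A \<union> B) \<le> delta_outer T A + delta_outer T B"
proof -
  have "delta_outer T (\<Union>n. binaryset A B n) \<le> (\<Sum>n. delta_outer T (binaryset A B n))"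
    using assms by (intro delta_outer_subadditive) (auto simp: binaryset_def)
  also have "\<dots> = delta_outer T A + delta_outer T B"
    using outer_measure_space_delta_outer[OF T_nonempty]
    by (intro suminf_binaryset_eq) (auto simp: outer_measure_space_def positive_def)
  finally show ?thesis
    by (simp add: UN_binaryset_eq)
qed

lemma ts_intervals_sequenceE:
  fixes A :: "nat \<Rightarrow> real set"
  assumes "range A \<subseteq> ts_intervals T"
  obtains c d where "\<And>n. c n \<in> T" "\<And>n. d n \<in> T" "\<And>n. c n \<le> d n"
    "\<And>n. A n = ts_interval T (c n) (d n)"
proof -
  have "\<exists>c d. c \<in> T \<and> d \<in> T \<and> c \<le> d \<and> A n = ts_interval T c d" for n
  proof -
    have "A n \<in> ts_intervals T" using assms by blast
    then show ?thesis unfolding ts_intervals_def by blast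
  qed
  then show thesis using that by metis
qed

lemma delta_outer_interval_le:
  assumes "c \<in> T" "d \<in> T" "c \<le> d" "X \<subseteq> ts_interval T c d"
  shows "delta_outer T X \<le> ennreal (d - c)"
proof -
  define A where "A n = ts_interval T c (if n = 0 then d else c)" for n :: nat
  have "delta_outer T X \<le> (\<Sum>n. ts_length T (A n))"
  proof (rule delta_outer_le)
    show "range A \<subseteq> ts_intervals T"
      unfolding A_def ts_intervals_def using assms(1-3) by fastforce
    have "X \<subseteq> A 0"
      using assms(4) by (simp add: A_def)
    then show "X \<subseteq> (\<Union>n. A n)" by blast
  qed
  also have "\<dots> = (\<Sum>n\<in>{0}. ts_length T (A n))"
    using assms by (intro suminf_finite) (auto simp: A_def ts_length_interval)
  also have "\<dots> = ennreal (d - c)"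
    using assms by (simp add: A_def ts_length_interval)
  finally show ?thesis .
qed

text \<open>A segment of \<open>T\<close> that is closed on the right at \<open>t\<close> is covered by the half-open interval up to any
  later point of \<open>T\<close>, and \<open>forward_jump T t\<close> is the infimum of these points. So the gap behind a
  right-scattered \<open>t\<close> counts, and right-dense and right-scattered points need no distinction.\<close>

lemma delta_outer_segment_le:
  assumes "c \<in> T" "c \<le> t" "X \<subseteq> {s \<in> T. c \<le> s \<and> s \<le> t}"
  shows "delta_outer T X \<le> ennreal (forward_jump T t - c)"
proof (rule ennreal_le_epsilon)
  fix e :: real assume "0 < e"
  then obtain d where d: "d \<in> T" "t < d" "d < forward_jump T t + e"
    using forward_jump_approx[of t "forward_jump T t + e"] by auto
  have "delta_outer T X \<le> ennreal (d - c)"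
    using assms d by (intro delta_outer_interval_le) (auto simp: ts_interval_def)
  also have "\<dots> \<le> ennreal (forward_jump T t - c + e)"
    using d by (intro ennreal_leI) auto
  also have "\<dots> = ennreal (forward_jump T t - c) + ennreal e"
    using assms le_forward_jump[of t] \<open>0 < e\<close> by (intro ennreal_plus) auto
  finally show "delta_outer T X \<le> ennreal (forward_jump T t - c) + ennreal e" .
qed

text \<open>The lower bound compares with Lebesgue measure on the line. Send a real \<open>x\<close> to the last point of
  \<open>T\<close> that is at most \<open>x\<close>. The preimage of the interval of \<open>T\<close> from \<open>c\<close> to \<open>d\<close> is the real
  interval \<open>{c..<d}\<close>, of the same length, and the points of \<open>{ts_min T..<forward_jump T t}\<close> are
  sent to points of \<open>T\<close> up to \<open>t\<close>. So a cover in \<open>T\<close> turns into a cover of that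
  real interval, whose total length is at least that of the interval.\<close>

lemma delta_outer_initial_ge:
  assumes t: "t \<in> T"
  shows "ennreal (forward_jump T t - ts_min T) \<le> delta_outer T {s \<in> T. s \<le> t}"
  unfolding delta_outer_def
proof (rule INF_greatest, clarsimp)
  fix A :: "nat \<Rightarrow> real set"
  assume A: "range A \<subseteq> ts_intervals T" and cover: "{s \<in> T. s \<le> t} \<subseteq> (\<Union>n. A n)"
  obtain c d where cd: "\<And>n. c n \<in> T" "\<And>n. d n \<in> T" "\<And>n. c n \<le> d n"
      "\<And>n. A n = ts_interval T (c n) (d n)"
    using ts_intervals_sequenceE[OF A] by blast
  have sub: "{ts_min T..<forward_jump T t} \<subseteq> (\<Union>n. {c n..<d n})"
  proof
    fix x assume x: "x \<in> {ts_min T..<forward_jump T t}"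
    \<comment> \<open>the last point of \<open>T\<close> that is at most \<open>x\<close>\<close>
    define p where "p = Sup {s \<in> T. s \<le> x}"
    have ne: "{s \<in> T. s \<le> x} \<noteq> {}" and bdd: "bdd_above {s \<in> T. s \<le> x}"
      using x ts_min_mem by (auto intro!: bdd_aboveI[of _ x])
    have "closed {s \<in> T. s \<le> x}"
      using closed_Int[OF T_closed closed_atMost[of x]] by (simp add: Int_def)
    then have p: "p \<in> T" "p \<le> x"
      using closed_contains_Sup[OF ne bdd] by (auto simp: p_def)
    have p_ge: "s \<le> p" if "s \<in> T" "s \<le> x" for s
      unfolding p_def using that bdd by (intro cSup_upper) auto
    have "p \<le> t"
      using forward_jump_le[of p t] p x by force
    then obtain n where "p \<in> A n"
      using cover p by auto
    then have "c n \<le> p" "p < d n"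
      using cd by (auto simp: ts_interval_def)
    then have "x \<in> {c n..<d n}"
      using p p_ge[OF cd(2)[of n]] by force
    then show "x \<in> (\<Union>n. {c n..<d n})"
      by blast
  qed
  have "ennreal (forward_jump T t - ts_min T) = emeasure lborel {ts_min T..<forward_jump T t}"
    using ts_min_le[OF forward_jump_mem] by simp
  also have "\<dots> \<le> emeasure lborel (\<Union>n. {c n..<d n})"
    using sub by (intro emeasure_mono) auto
  also have "\<dots> \<le> (\<Sum>n. emeasure lborel {c n..<d n})"
    by (intro emeasure_subadditive_countably) auto
  also have "\<dots> = (\<Sum>n. ts_length T (A n))"
    using cd by (simp add: ts_length_interval)
  finally show "ennreal (forward_jump T t - ts_min T) \<le> (\<Sum>n. ts_length T (A n))" .
qed

text \<open>Caratheodory's condition for initial segments reduces to covering intervals. The length splits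
  without loss at \<open>forward_jump T t\<close>, which is itself a point of \<open>T\<close>: the part up to \<open>t\<close> has at most
  the length up to the jump, and the rest begins only there.\<close>

lemma interval_split_le:
  fixes t :: real
  assumes "c \<in> T" "d \<in> T" "c \<le> d"
  defines "I \<equiv> ts_interval T c d" and "H \<equiv> {s \<in> T. s \<le> t}"
  shows "delta_outer T (I \<inter> H) + delta_outer T (I - H) \<le> ennreal (d - c)"
proof -
  have empty: "delta_outer T {} = 0"
    using outer_measure_space_delta_outer[OF T_nonempty]
    by (simp add: outer_measure_space_def positive_def)
  have whole: "delta_outer T I \<le> ennreal (d - c)"
    using assms by (intro delta_outer_interval_le) auto
  consider "t < c" | "d \<le> t" | "c \<le> t" "t < d" by linarith
  then show ?thesis
  proof cases
    case 1
    then have "I \<inter> H = {}" "I - H = I" by (auto simp: I_def H_def ts_interval_def)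
    then show ?thesis using whole empty by simp
  next
    case 2
    then have "I - H = {}" "I \<inter> H = I" by (auto simp: I_def H_def ts_interval_def)
    then show ?thesis using whole by (simp only: empty add_0_right)
  next
    case 3
    have jump: "forward_jump T t \<le> d"
      using forward_jump_le assms 3 by auto
    have "delta_outer T (I \<inter> H) \<le> ennreal (forward_jump T t - c)"
      using assms 3 by (intro delta_outer_segment_le) (auto simp: I_def H_def ts_interval_def)
    moreover have "delta_outer T (I - H) \<le> ennreal (d - forward_jump T t)"
      using assms forward_jump_mem jump forward_jump_le
      by (intro delta_outer_interval_le) (auto simp: ts_interval_def I_def H_def)
    ultimately have "delta_outer T (I \<inter> H) + delta_outer T (I - H)
        \<le> ennreal (forward_jump T t - c) + ennreal (d - forward_jump T t)"
      by (rule add_mono)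
    also have "\<dots> = ennreal (d - c)"
      using jump 3 le_forward_jump[of t] by (subst ennreal_plus[symmetric]) auto
    finally show ?thesis .
  qed
qed

lemma initial_in_delta_sets: "{s \<in> T. s \<le> t} \<in> delta_sets T"
  unfolding mem_delta_sets_iff
proof (intro conjI allI impI antisym)
  let ?H = "{s \<in> T. s \<le> t}"
  fix X assume X: "X \<subseteq> T"
  show "delta_outer T X \<le> delta_outer T (X \<inter> ?H) + delta_outer T (X - ?H)"
    using delta_outer_Un[of "X \<inter> ?H" "X - ?H"] X by (auto simp: Int_Diff_Un)
  show "delta_outer T (X \<inter> ?H) + delta_outer T (X - ?H) \<le> delta_outer T X"
    unfolding delta_outer_def[of T X]
  proof (rule INF_greatest, clarsimp)
    fix A :: "nat \<Rightarrow> real set"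
    assume A: "range A \<subseteq> ts_intervals T" and cover: "X \<subseteq> (\<Union>n. A n)"
    obtain c d where cd: "\<And>n. c n \<in> T" "\<And>n. d n \<in> T" "\<And>n. c n \<le> d n"
        "\<And>n. A n = ts_interval T (c n) (d n)"
      using ts_intervals_sequenceE[OF A] by blast
    have AT: "A n \<subseteq> T" for n
      unfolding cd(4) ts_interval_def by auto
    have "delta_outer T (X \<inter> ?H) \<le> delta_outer T (\<Union>n. A n \<inter> ?H)"
      using cover by (intro delta_outer_mono) auto
    also have "\<dots> \<le> (\<Sum>n. delta_outer T (A n \<inter> ?H))"
      using AT by (intro delta_outer_subadditive) auto
    finally have 1: "delta_outer T (X \<inter> ?H) \<le> (\<Sum>n. delta_outer T (A n \<inter> ?H))" .
    have "delta_outer T (X - ?H) \<le> delta_outer T (\<Union>n. A n - ?H)"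
      using cover by (intro delta_outer_mono) auto
    also have "\<dots> \<le> (\<Sum>n. delta_outer T (A n - ?H))"
      using AT by (intro delta_outer_subadditive) auto
    finally have 2: "delta_outer T (X - ?H) \<le> (\<Sum>n. delta_outer T (A n - ?H))" .
    have "delta_outer T (A n \<inter> ?H) + delta_outer T (A n - ?H) \<le> ts_length T (A n)" for n
      unfolding cd(4) ts_length_interval[OF cd(1-3)] by (rule interval_split_le[OF cd(1-3)])
    then have "(\<Sum>n. delta_outer T (A n \<inter> ?H) + delta_outer T (A n - ?H)) \<le> (\<Sum>n. ts_length T (A n))"
      by (intro suminf_le) auto
    moreover have "(\<Sum>n. delta_outer T (A n \<inter> ?H) + delta_outer T (A n - ?H)) =
        (\<Sum>n. delta_outer T (A n \<inter> ?H)) + (\<Sum>n. delta_outer T (A n - ?H))"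
      by (intro suminf_add[symmetric]) auto
    ultimately show "delta_outer T (X \<inter> ?H) + delta_outer T (X - ?H) \<le> (\<Sum>n. ts_length T (A n))"
      using add_mono[OF 1 2] by simp
  qed
qed auto

abbreviation "M \<equiv> delta_measure T"

lemma sets_initial: "{s \<in> T. s \<le> t} \<in> sets M"
  using initial_in_delta_sets by (simp add: sets_delta_measure[OF T_nonempty])

lemma emeasure_initial:
  assumes "t \<in> T"
  shows "emeasure M {s \<in> T. s \<le> t} = ennreal (forward_jump T t - ts_min T)"
proof -
  have "delta_outer T {s \<in> T. s \<le> t} \<le> ennreal (forward_jump T t - ts_min T)"
    using assms ts_min_mem ts_min_le by (intro delta_outer_segment_le) auto
  then show ?thesis
    using delta_outer_initial_ge[OF assms]
    by (simp add: emeasure_delta_measure[OF T_nonempty initial_in_delta_sets])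
qed

lemma measure_initial:
  "t \<in> T \<Longrightarrow> measure M {s \<in> T. s \<le> t} = forward_jump T t - ts_min T"
  using emeasure_initial ts_min_le[OF forward_jump_mem] by (simp add: measure_def)

lemma fmeasurable_truncation:
  assumes "A \<in> sets M" "t \<in> T"
  shows "{s \<in> A. s \<le> t} \<in> fmeasurable M"
proof (rule fmeasurableI2)
  show "{s \<in> T. s \<le> t} \<in> fmeasurable M"
    using assms sets_initial by (intro fmeasurableI) (auto simp: emeasure_initial)
  show sub: "{s \<in> A. s \<le> t} \<subseteq> {s \<in> T. s \<le> t}"
    using sets.sets_into_space[OF assms(1)] by auto
  have "{s \<in> A. s \<le> t} = A \<inter> {s \<in> T. s \<le> t}"
    using sub by blast
  then show "{s \<in> A. s \<le> t} \<in> sets M"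
    using assms sets_initial by auto
qed

lemma measure_truncation_mono:
  assumes "A \<in> sets M" "B \<in> sets M" "t \<in> T" "\<And>s. s \<in> A \<Longrightarrow> s \<le> t \<Longrightarrow> s \<in> B"
  shows "measure M {s \<in> A. s \<le> t} \<le> measure M {s \<in> B. s \<le> t}"
  using assms fmeasurable_truncation
  by (intro measure_mono_fmeasurable) (auto intro: fmeasurableD)


section \<open>Sets of density zero\<close>

text \<open>Because \<open>T\<close> is unbounded, limits along \<open>T\<close>, and hence densities, are unique.\<close>

lemma at_top_in_nontrivial: "at_top_in T \<noteq> bot"
  unfolding trivial_limit_def eventually_at_top_in using ex_greater less_imp_le by blast

lemma eventually_in_at_top_in: "\<forall>\<^sub>F t in at_top_in T. t \<in> T \<and> x \<le> t"
  by (auto simp: eventually_at_top_in)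

lemma eventually_length_pos:
  "\<forall>\<^sub>F t in at_top_in T. t \<in> T \<and> 0 < forward_jump T t - ts_min T"
proof (rule eventually_mono[OF eventually_in_at_top_in[of "ts_min T + 1"]])
  fix t assume "t \<in> T \<and> ts_min T + 1 \<le> t"
  then show "t \<in> T \<and> 0 < forward_jump T t - ts_min T"
    using le_forward_jump[of t] by linarith
qed

lemma density_zero_boundI:
  assumes A: "A \<in> sets M"
    and lim: "(u \<longlongrightarrow> 0) (at_top_in T)"
    and bound: "\<forall>\<^sub>F t in at_top_in T.
      measure M {s \<in> A. s \<le> t} / (forward_jump T t - ts_min T) \<le> u t"
  shows "has_delta_density T A 0"
  unfolding has_delta_density_def
proof (intro conjI A)
  show "((\<lambda>t. measure M {s \<in> A. s \<le> t} / (forward_jump T t - ts_min T)) \<longlongrightarrow> 0) (at_top_in T)"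
  proof (rule tendsto_sandwich[OF _ bound tendsto_const lim])
    show "\<forall>\<^sub>F t in at_top_in T. 0 \<le> measure M {s \<in> A. s \<le> t} / (forward_jump T t - ts_min T)"
      by (rule eventually_mono[OF eventually_length_pos]) auto
  qed
qed

lemma density_zero_subset:
  assumes "has_delta_density T A 0" "B \<in> sets M" "B \<subseteq> A"
  shows "has_delta_density T B 0"
proof (rule density_zero_boundI)
  have A: "A \<in> sets M"
    and lim: "((\<lambda>t. measure M {s \<in> A. s \<le> t} / (forward_jump T t - ts_min T)) \<longlongrightarrow> 0) (at_top_in T)"
    using assms(1) by (auto simp: has_delta_density_def)
  show "((\<lambda>t. measure M {s \<in> A. s \<le> t} / (forward_jump T t - ts_min T)) \<longlongrightarrow> 0) (at_top_in T)"
    by (rule lim)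
  show "\<forall>\<^sub>F t in at_top_in T. measure M {s \<in> B. s \<le> t} / (forward_jump T t - ts_min T)
      \<le> measure M {s \<in> A. s \<le> t} / (forward_jump T t - ts_min T)"
    by (rule eventually_mono[OF eventually_length_pos])
      (use A assms in \<open>auto intro!: divide_right_mono measure_truncation_mono\<close>)
qed fact

lemma density_zero_Un:
  assumes "has_delta_density T A 0" "has_delta_density T B 0"
  shows "has_delta_density T (A \<union> B) 0"
proof (rule density_zero_boundI)
  have sets: "A \<in> sets M" "B \<in> sets M"
    using assms by (auto simp: has_delta_density_def)
  then show "A \<union> B \<in> sets M" by auto
  let ?q = "\<lambda>A t. measure M {s \<in> A. s \<le> t} / (forward_jump T t - ts_min T)"
  show "((\<lambda>t. ?q A t + ?q B t) \<longlongrightarrow> 0) (at_top_in T)"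
    using assms tendsto_add_zero by (auto simp: has_delta_density_def)
  show "\<forall>\<^sub>F t in at_top_in T. ?q (A \<union> B) t \<le> ?q A t + ?q B t"
  proof (rule eventually_mono[OF eventually_length_pos])
    fix t assume t: "t \<in> T \<and> 0 < forward_jump T t - ts_min T"
    have "{s \<in> A \<union> B. s \<le> t} = {s \<in> A. s \<le> t} \<union> {s \<in> B. s \<le> t}" by auto
    then have "measure M {s \<in> A \<union> B. s \<le> t} \<le> measure M {s \<in> A. s \<le> t} + measure M {s \<in> B. s \<le> t}"
      using fmeasurable_truncation sets t by (auto intro!: measure_Un_le fmeasurableD)
    then show "?q (A \<union> B) t \<le> ?q A t + ?q B t"
      using t by (simp add: divide_right_mono flip: add_divide_distrib)
  qed
qed

text \<open>The truncated measure is eventually constant, while the length of the initial segment tends to infinity.\<close>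

lemma density_zero_bounded:
  assumes A: "A \<in> sets M" and bdd: "bdd_above A"
  shows "has_delta_density T A 0"
proof -
  obtain b where b: "b \<in> T" "\<And>s. s \<in> A \<Longrightarrow> s \<le> b"
    using bdd ex_greater unfolding bdd_above_def by (meson less_imp_le order_trans)
  define C where "C = measure M {s \<in> A. s \<le> b}"
  have "filterlim (\<lambda>t. forward_jump T t - ts_min T) at_top (at_top_in T)"
  proof (rule filterlim_at_top_mono)
    show "filterlim (\<lambda>t. - ts_min T + t) at_top (at_top_in T)"
      unfolding at_top_in_def
      by (intro filterlim_tendsto_add_at_top[OF tendsto_const] filterlim_mono[OF filterlim_ident order_refl inf_le1])
    show "\<forall>\<^sub>F t in at_top_in T. - ts_min T + t \<le> forward_jump T t - ts_min T"
      using le_forward_jump by (intro always_eventually) auto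
  qed
  then have "((\<lambda>t. C / (forward_jump T t - ts_min T)) \<longlongrightarrow> 0) (at_top_in T)"
    by (intro tendsto_divide_0[OF tendsto_const] filterlim_at_top_imp_at_infinity)
  moreover have "\<forall>\<^sub>F t in at_top_in T.
      measure M {s \<in> A. s \<le> t} / (forward_jump T t - ts_min T) \<le> C / (forward_jump T t - ts_min T)"
  proof (rule eventually_mono[OF eventually_conj[OF eventually_length_pos eventually_in_at_top_in[of b]]])
    fix t assume t: "(t \<in> T \<and> 0 < forward_jump T t - ts_min T) \<and> t \<in> T \<and> b \<le> t"
    then have "{s \<in> A. s \<le> t} = {s \<in> A. s \<le> b}"
      using b(2) by force
    then show "measure M {s \<in> A. s \<le> t} / (forward_jump T t - ts_min T)
        \<le> C / (forward_jump T t - ts_min T)"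
      by (simp add: C_def)
  qed
  ultimately show ?thesis
    by (rule density_zero_boundI[OF A])
qed

text \<open>The measure of an initial segment is exactly the normalising length, so the two quotients add up
  to one as soon as that length is positive.\<close>

lemma density_complement:
  assumes "has_delta_density T A c"
  shows "has_delta_density T (T - A) (1 - c)"
  unfolding has_delta_density_def
proof
  have A: "A \<in> sets M"
    using assms by (auto simp: has_delta_density_def)
  then show "T - A \<in> sets M"
    using sets.compl_sets[of A M] by simp
  let ?q = "\<lambda>A t. measure M {s \<in> A. s \<le> t} / (forward_jump T t - ts_min T)"
  have "((\<lambda>t. 1 - ?q A t) \<longlongrightarrow> 1 - c) (at_top_in T)"
    using assms by (intro tendsto_diff tendsto_const) (auto simp: has_delta_density_def)
  moreover have "\<forall>\<^sub>F t in at_top_in T. 1 - ?q A t = ?q (T - A) t"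
  proof (rule eventually_mono[OF eventually_length_pos])
    fix t assume t: "t \<in> T \<and> 0 < forward_jump T t - ts_min T"
    have "{s \<in> T - A. s \<le> t} = {s \<in> T. s \<le> t} - {s \<in> A. s \<le> t}" by auto
    moreover have "measure M ({s \<in> T. s \<le> t} - {s \<in> A. s \<le> t}) =
        measure M {s \<in> T. s \<le> t} - measure M {s \<in> A. s \<le> t}"
    proof (rule measurable_measure_Diff)
      show "{s \<in> T. s \<le> t} \<in> fmeasurable M"
        using fmeasurable_truncation[of T t] sets.top[of M] t by simp
      show "{s \<in> A. s \<le> t} \<in> sets M"
        using fmeasurable_truncation[OF A] t by (intro fmeasurableD) simp
      show "{s \<in> A. s \<le> t} \<subseteq> {s \<in> T. s \<le> t}"
        using sets.sets_into_space[OF A] by auto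
    qed
    ultimately have "measure M {s \<in> T - A. s \<le> t} =
        (forward_jump T t - ts_min T) - measure M {s \<in> A. s \<le> t}"
      using measure_initial t by simp
    moreover have "1 - x / l = (l - x) / l" if "0 < l" for x l :: real
      using that by (simp add: field_simps)
    ultimately show "1 - ?q A t = ?q (T - A) t"
      using t by (simp only:)
  qed
  ultimately show "(?q (T - A) \<longlongrightarrow> 1 - c) (at_top_in T)"
    by (rule Lim_transform_eventually)
qed

lemma density_one_iff:
  assumes "K \<subseteq> T"
  shows "has_delta_density T K 1 \<longleftrightarrow> has_delta_density T (T - K) 0"
proof -
  have K: "T - (T - K) = K"
    using assms by blast
  show ?thesis
    using density_complement[of K 1] density_complement[of "T - K" 0]
    unfolding K diff_self diff_zero by (rule iffI)
qed

text \<open>If the two sets were disjoint, \<open>T\<close> would be the union of their complements and hence of density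
  zero, whereas it has density one.\<close>

lemma density_one_Int_nonempty:
  assumes "has_delta_density T K 1" "has_delta_density T K' 1" "K \<subseteq> T" "K' \<subseteq> T"
  shows "K \<inter> K' \<noteq> {}"
proof
  assume "K \<inter> K' = {}"
  then have "(T - K) \<union> (T - K') = T" by blast
  moreover have "has_delta_density T ((T - K) \<union> (T - K')) 0"
    using assms density_one_iff by (intro density_zero_Un) auto
  ultimately have zero: "has_delta_density T T 0" by simp
  have one: "has_delta_density T T 1"
    using density_one_iff[of T] density_zero_bounded[of "{}"] by simp
  have "(0::real) = 1"
    by (rule tendsto_unique[OF at_top_in_nontrivial
          zero[unfolded has_delta_density_def, THEN conjunct2]
          one[unfolded has_delta_density_def, THEN conjunct2]])
  then show False by simp
qed

text \<open>The ideal of sets of density zero is a P-ideal. Let \<open>B n\<close> contribute to \<open>Z\<close> only beyond a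
  threshold \<open>\<tau> n\<close> after which its relative measure stays below \<open>1/(n+1)\<close>. If \<open>n\<close> is the last index
  whose threshold lies before \<open>t\<close>, then up to \<open>t\<close> only \<open>B 0, ..., B n\<close> have contributed, all of
  them inside \<open>B n\<close>, so the relative measure of \<open>Z\<close> at \<open>t\<close> is below \<open>1/(n+1)\<close>;
  and \<open>n\<close> grows beyond every bound with \<open>t\<close>.\<close>

lemma density_zero_almost_union:
  assumes B: "\<And>n::nat. has_delta_density T (B n) 0" and mono: "incseq B"
  obtains Z \<tau> where "has_delta_density T Z 0" "\<And>n s. s \<in> B n \<Longrightarrow> \<tau> n < s \<Longrightarrow> s \<in> Z"
proof -
  let ?q = "\<lambda>A t. measure M {s \<in> A. s \<le> t} / (forward_jump T t - ts_min T)"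
  have "\<exists>N. \<forall>t\<in>T. N \<le> t \<longrightarrow> ?q (B n) t < inverse (real (Suc n))" for n
  proof -
    have "(?q (B n) \<longlongrightarrow> 0) (at_top_in T)"
      using B by (auto simp: has_delta_density_def)
    then have "\<forall>\<^sub>F t in at_top_in T. ?q (B n) t < inverse (real (Suc n))"
      by (rule order_tendstoD) simp
    then show ?thesis
      by (simp add: eventually_at_top_in)
  qed
  then obtain N where N: "\<And>n t. t \<in> T \<Longrightarrow> N n \<le> t \<Longrightarrow> ?q (B n) t < inverse (real (Suc n))"
    by metis
  \<comment> \<open>\<open>\<tau> n \<ge> n\<close> leaves only finitely many thresholds before a given \<open>t\<close>, so a last one exists\<close>
  define \<tau> where "\<tau> n = max (N n) (real n)" for n
  define Z where "Z = (\<Union>n. {s \<in> B n. \<tau> n < s})"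
  have Bsets: "B n \<in> sets M" for n
    using B by (auto simp: has_delta_density_def)
  have BT: "B n \<subseteq> T" for n
    using sets.sets_into_space[OF Bsets[of n]] by simp
  have "{s \<in> B n. \<tau> n < s} = B n - {s \<in> T. s \<le> \<tau> n}" for n
    using BT by auto
  then have Z: "Z \<in> sets M"
    using Bsets sets_initial by (auto simp: Z_def)
  have "(?q Z \<longlongrightarrow> 0) (at_top_in T)"
  proof (rule order_tendstoI)
    fix e :: real assume "e < 0"
    then show "\<forall>\<^sub>F t in at_top_in T. e < ?q Z t"
      by (intro eventually_mono[OF eventually_length_pos])
        (simp add: less_le_trans[OF _ divide_nonneg_pos])
  next
    fix e :: real assume "0 < e"
    then obtain k where k: "inverse (real (Suc k)) < e"
      using reals_Archimedean by blast
    show "\<forall>\<^sub>F t in at_top_in T. ?q Z t < e"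
    proof (rule eventually_mono[OF eventually_conj[OF eventually_length_pos
            eventually_in_at_top_in[of "\<tau> k + 1"]]])
      fix t assume t: "(t \<in> T \<and> 0 < forward_jump T t - ts_min T) \<and> t \<in> T \<and> \<tau> k + 1 \<le> t"
      define F where "F = {m. \<tau> m < t}"
      have "F \<subseteq> {..nat \<lceil>t\<rceil>}"
        by (auto simp: F_def \<tau>_def) linarith
      then have fin: "finite F"
        by (rule finite_subset) simp
      have kF: "k \<in> F"
        using t by (auto simp: F_def)
      define n where "n = Max F"
      have n: "n \<in> F" "\<And>m. m \<in> F \<Longrightarrow> m \<le> n"
        using fin kF by (auto simp: n_def intro: Max_in)
      have "?q Z t \<le> ?q (B n) t"
      proof (intro divide_right_mono measure_truncation_mono Z Bsets)
        fix s assume "s \<in> Z" "s \<le> t"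
        then obtain m where "s \<in> B m" "m \<in> F"
          by (auto simp: Z_def F_def)
        then show "s \<in> B n"
          using n(2) mono by (meson incseqD subsetD)
      qed (use t in auto)
      also have "\<dots> < inverse (real (Suc n))"
        using N[of t n] n(1) t by (auto simp: F_def \<tau>_def)
      also have "\<dots> \<le> inverse (real (Suc k))"
        using n(2)[OF kF] by (intro le_imp_inverse_le) auto
      finally show "?q Z t < e"
        using k by simp
    qed
  qed
  then have "has_delta_density T Z 0"
    using Z by (simp add: has_delta_density_def)
  then show thesis
    by (rule that) (auto simp: Z_def)
qed


section \<open>Convergence in density\<close>

lemma delta_Cauchy_if_convergent:
  assumes "delta_converges_to T f L"
  shows "delta_Cauchy T f"
  unfolding delta_Cauchy_def
proof (intro allI impI)
  fix e :: real assume "0 < e"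
  then have "0 < e / 2" by simp
  then obtain K where K: "K \<subseteq> T" "has_delta_density T K 1" "\<And>t. t \<in> K \<Longrightarrow> \<bar>f t - L\<bar> < e / 2"
    using assms unfolding delta_converges_to_def by meson
  obtain t0 where t0: "t0 \<in> K"
    using density_one_Int_nonempty[OF K(2) K(2)] K(1) by auto
  have "\<bar>f t - f t0\<bar> < e" if "t \<in> K" for t
    using K(3)[OF that] K(3)[OF t0] by arith
  then show "\<exists>K\<subseteq>T. \<exists>t0\<in>T. has_delta_density T K 1 \<and> (\<forall>t\<in>K. \<bar>f t - f t0\<bar> < e)"
    using K(1,2) t0 by (intro exI[of _ K] conjI bexI[of _ t0]) auto
qed

text \<open>The values at the reference points of the Cauchy condition form a Cauchy sequence of reals: two sets of
  density one meet, and at a common point \<open>f\<close> is close to both values.\<close>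

lemma delta_convergent_if_Cauchy:
  assumes "delta_Cauchy T f"
  obtains L where "delta_converges_to T f L"
proof -
  have "\<exists>K x. K \<subseteq> T \<and> has_delta_density T K 1 \<and> (\<forall>t\<in>K. \<bar>f t - x\<bar> < inverse (real (Suc n)))" for n
  proof -
    have "0 < inverse (real (Suc n))" by simp
    then show ?thesis
      using assms unfolding delta_Cauchy_def by meson
  qed
  then obtain K x where K: "\<And>n. K n \<subseteq> T" "\<And>n. has_delta_density T (K n) 1"
    and x: "\<And>n t. t \<in> K n \<Longrightarrow> \<bar>f t - x n\<bar> < inverse (real (Suc n))"
    by metis
  have close: "\<bar>x m - x n\<bar> \<le> inverse (real (Suc m)) + inverse (real (Suc n))" for m n
  proof -
    obtain t where "t \<in> K m" "t \<in> K n"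
      using density_one_Int_nonempty[OF K(2) K(2) K(1) K(1), of m n] by auto
    then show ?thesis
      using x[of t m] x[of t n] by arith
  qed
  have small: "inverse (real (Suc m)) \<le> inverse (real (Suc k))" if "k \<le> m" for k m
    using that by (intro le_imp_inverse_le) auto
  have "Cauchy x"
  proof (rule metric_CauchyI)
    fix e :: real assume "0 < e"
    then obtain k where k: "inverse (real (Suc k)) < e / 2"
      using reals_Archimedean[of "e / 2"] by auto
    have "dist (x m) (x n) < e" if "k \<le> m" "k \<le> n" for m n
      using close[of m n] small[OF that(1)] small[OF that(2)] k
      unfolding dist_real_def by linarith
    then show "\<exists>k. \<forall>m\<ge>k. \<forall>n\<ge>k. dist (x m) (x n) < e"
      by blast
  qed
  then obtain L where L: "x \<longlonglongrightarrow> L"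
    by (auto simp: Cauchy_convergent_iff convergent_def)
  have "\<exists>K\<subseteq>T. has_delta_density T K 1 \<and> (\<forall>t\<in>K. \<bar>f t - L\<bar> < e)" if "0 < e" for e
  proof -
    obtain k where k: "inverse (real (Suc k)) < e / 2"
      using reals_Archimedean[of "e / 2"] \<open>0 < e\<close> by auto
    have "\<forall>\<^sub>F n in sequentially. dist (x n) L < e / 2"
      using L \<open>0 < e\<close> by (intro tendstoD) auto
    then obtain n where n: "k \<le> n" "\<bar>x n - L\<bar> < e / 2"
      unfolding eventually_sequentially dist_real_def by (meson nat_le_linear)
    have "\<bar>f t - L\<bar> < e" if "t \<in> K n" for t
      using x[OF that] small[OF n(1)] n(2) k by arith
    then show ?thesis
      using K by blast
  qed
  then show thesis
    by (intro that) (auto simp: delta_converges_to_def)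
qed

lemma sets_far:
  fixes f :: "real \<Rightarrow> real"
  assumes "f \<in> borel_measurable M"
  shows "{t \<in> T. e \<le> \<bar>f t - L\<bar>} \<in> sets M"
proof -
  have "{t \<in> space M. e \<le> \<bar>f t - L\<bar>} \<in> sets M"
    using assms by measurable
  then show ?thesis by simp
qed

text \<open>For measurable \<open>f\<close> the witnessing sets can be eliminated: the exceptional sets
  themselves are measurable, so being contained in a set of density zero gives them density zero.\<close>

lemma delta_converges_to_iff:
  assumes "f \<in> borel_measurable M"
  shows "delta_converges_to T f L \<longleftrightarrow> (\<forall>e>0. has_delta_density T {t \<in> T. e \<le> \<bar>f t - L\<bar>} 0)"
    (is "_ \<longleftrightarrow> ?far")
proof
  assume conv: "delta_converges_to T f L"
  show ?far
  proof (intro allI impI)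
    fix e :: real assume "0 < e"
    then obtain K where K: "K \<subseteq> T" "has_delta_density T K 1" "\<And>t. t \<in> K \<Longrightarrow> \<bar>f t - L\<bar> < e"
      using conv unfolding delta_converges_to_def by meson
    show "has_delta_density T {t \<in> T. e \<le> \<bar>f t - L\<bar>} 0"
    proof (rule density_zero_subset)
      show "has_delta_density T (T - K) 0"
        using K by (simp add: density_one_iff)
      show "{t \<in> T. e \<le> \<bar>f t - L\<bar>} \<subseteq> T - K"
        using K(3) by force
    qed (rule sets_far[OF assms])
  qed
next
  assume far: ?far
  have "has_delta_density T {t \<in> T. \<bar>f t - L\<bar> < e} 1" if "0 < e" for e
  proof -
    have "T - {t \<in> T. \<bar>f t - L\<bar> < e} = {t \<in> T. e \<le> \<bar>f t - L\<bar>}" by auto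
    then show ?thesis
      using far that by (simp add: density_one_iff)
  qed
  then show "delta_converges_to T f L"
    unfolding delta_converges_to_def by (intro allI impI exI[of _ "{t \<in> T. \<bar>f t - L\<bar> < _}"]) auto
qed

text \<open>One set \<open>Z\<close> of density zero absorbs, up to bounded sets, all the sets on which \<open>f\<close> stays away from
  \<open>L\<close>. Overwriting \<open>f\<close> by \<open>L\<close> on \<open>Z\<close> therefore yields an ordinarily convergent function.\<close>

lemma delta_convergent_imp_almost_convergent:
  assumes f: "f \<in> borel_measurable M" and conv: "delta_converges_to T f L"
  obtains g where "g \<in> borel_measurable M" "(g \<longlongrightarrow> L) (at_top_in T)"
    "delta_almost_all T (\<lambda>t. f t = g t)"
proof -
  define B where "B n = {t \<in> T. inverse (real (Suc n)) \<le> \<bar>f t - L\<bar>}" for n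
  have zero: "has_delta_density T (B n) 0" for n
    using conv unfolding delta_converges_to_iff[OF f] B_def by simp
  have mono: "incseq B"
  proof (rule incseq_SucI)
    fix n
    have "inverse (real (Suc (Suc n))) \<le> inverse (real (Suc n))"
      by (intro le_imp_inverse_le) auto
    then show "B n \<subseteq> B (Suc n)"
      unfolding B_def using order_trans by blast
  qed
  obtain Z \<tau> where Z: "has_delta_density T Z 0"
    and in_Z: "\<And>n s. s \<in> B n \<Longrightarrow> \<tau> n < s \<Longrightarrow> s \<in> Z"
    using density_zero_almost_union[OF zero mono] by blast
  have Zsets: "Z \<in> sets M"
    using Z by (simp add: has_delta_density_def)
  define g where "g t = (if t \<in> Z then L else f t)" for t
  have g: "g \<in> borel_measurable M"
    unfolding g_def using f Zsets by (intro measurable_If_set) (auto simp: sets.Int_space_eq2[OF Zsets, simplified])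
  have "(g \<longlongrightarrow> L) (at_top_in T)"
  proof (rule tendstoI)
    fix e :: real assume "0 < e"
    then obtain n where n: "inverse (real (Suc n)) < e"
      using reals_Archimedean by blast
    show "\<forall>\<^sub>F t in at_top_in T. dist (g t) L < e"
    proof (rule eventually_mono[OF eventually_in_at_top_in[of "\<tau> n + 1"]])
      fix t assume t: "t \<in> T \<and> \<tau> n + 1 \<le> t"
      show "dist (g t) L < e"
      proof (cases "t \<in> Z")
        case True
        then show ?thesis using \<open>0 < e\<close> by (simp add: g_def)
      next
        case False
        then have "t \<notin> B n"
          using in_Z[of t n] t by auto
        then show ?thesis
          using False t n by (auto simp: B_def g_def dist_real_def)
      qed
    qed
  qed
  moreover have "delta_almost_all T (\<lambda>t. f t = g t)"
    unfolding delta_almost_all_def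
  proof (rule density_zero_subset[OF Z])
    have "{t \<in> space M. f t \<noteq> g t} \<in> sets M"
      using f g by measurable
    then show "{t \<in> T. f t \<noteq> g t} \<in> sets M" by simp
    show "{t \<in> T. f t \<noteq> g t} \<subseteq> Z"
      by (auto simp: g_def)
  qed
  ultimately show thesis
    by (rule that[OF g])
qed

lemma almost_convergent_imp_delta_convergent:
  assumes f: "f \<in> borel_measurable M" and lim: "(g \<longlongrightarrow> L) (at_top_in T)"
    and eq: "delta_almost_all T (\<lambda>t. f t = g t)"
  shows "delta_converges_to T f L"
  unfolding delta_converges_to_iff[OF f]
proof (intro allI impI)
  fix e :: real assume "0 < e"
  then obtain N where N: "\<And>t. t \<in> T \<Longrightarrow> N \<le> t \<Longrightarrow> \<bar>g t - L\<bar> < e"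
    using tendstoD[OF lim] unfolding eventually_at_top_in dist_real_def by meson
  have "has_delta_density T {s \<in> T. s \<le> N} 0"
    using sets_initial by (intro density_zero_bounded) (auto intro: bdd_aboveI[of _ N])
  with eq have "has_delta_density T ({t \<in> T. f t \<noteq> g t} \<union> {s \<in> T. s \<le> N}) 0"
    unfolding delta_almost_all_def by (rule density_zero_Un)
  then show "has_delta_density T {t \<in> T. e \<le> \<bar>f t - L\<bar>} 0"
  proof (rule density_zero_subset)
    show "{t \<in> T. e \<le> \<bar>f t - L\<bar>} \<subseteq> {t \<in> T. f t \<noteq> g t} \<union> {s \<in> T. s \<le> N}"
      using N by force
  qed (rule sets_far[OF f])
qed

end

theorem theorem3:
  fixes T :: "real set" and f :: "real \<Rightarrow> real"
  assumes "time_scale T" and "\<not> bdd_above T" and "has_minimum T"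
    and "f \<in> borel_measurable (delta_measure T)"
  shows "((\<exists>L. delta_converges_to T f L) \<longleftrightarrow> delta_Cauchy T f) \<and>
    (delta_Cauchy T f \<longleftrightarrow>
      (\<exists>g. g \<in> borel_measurable (delta_measure T) \<and>
        (\<exists>l::real. (g \<longlongrightarrow> l) (at_top_in T)) \<and>
        delta_almost_all T (\<lambda>t. f t = g t)))"
proof -
  interpret unbounded_time_scale T
    using assms by unfold_locales
  have Cauchy: "(\<exists>L. delta_converges_to T f L) \<longleftrightarrow> delta_Cauchy T f"
    using delta_Cauchy_if_convergent delta_convergent_if_Cauchy by metis
  moreover have "(\<exists>L. delta_converges_to T f L) \<longleftrightarrow>
      (\<exists>g. g \<in> borel_measurable (delta_measure T) \<and>
        (\<exists>l::real. (g \<longlongrightarrow> l) (at_top_in T)) \<and>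
        delta_almost_all T (\<lambda>t. f t = g t))"
    using delta_convergent_imp_almost_convergent[OF assms(4)]
      almost_convergent_imp_delta_convergent[OF assms(4)] by metis
  ultimately show ?thesis by simp
qed

end
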